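(* Over the field $K=\mathbb{Z}_2$ there exist a $(4,5,5)$-matrix multiplication scheme of rank $73$ and a $(5,5,5)$-matrix multiplication scheme of rank $94$. That is, $\mathcal{M}_{4,5,5}$ can be written over $\mathbb{Z}_2$ as a sum of $73$ rank-one tensors, and $\mathcal{M}_{5,5,5}$ can be written over $\mathbb{Z}_2$ as a sum of $94$ rank-one tensors.
   Context: Over a field $K$, for positive integers $n,m,p$, the matrix multiplication tensor is $$\mathcal{M}_{n,m,p}=\sum_{i=1}^{n}\sum_{j=1}^{m}\sum_{k=1}^{p} a_{i,j}\otimes b_{j,k}\otimes c_{k,i}\in K^{n\times m}\otimes K^{m\times p}\otimes K^{p\times n},$$ where $a_{u,v}$, $b_{u,v}$, $c_{u,v}$ are the matrices of sizes $n\times m$, $m\times p$, $p\times n$ respectively with a $1$ at position $(u,v)$ and zeros elsewhere. A rank-one tensor is one of the form $\alpha\otimes\beta\otimes\gamma$ with $\alpha,\beta,\gamma$ nonzero. An $(n,m,p)$-matrix multiplication scheme is a finite multiset $S$ of rank-one tensors in $K^{n\times m}\otimes K^{m\times p}\otimes K^{p\times n}$ whose sum is $\mathcal{M}_{n,m,p}$; its cardinality $|S|$ is called the rank of the scheme. *)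

theory Defs
  imports
    "HOL-Analysis.Finite_Cartesian_Product"
    "HOL-Library.Multiset"
    "HOL-Library.Z2"
begin

text \<open>
  An \<open>n \<times> m\<close> matrix over \<open>K\<close> has type \<open>'a^'m^'n\<close> (outer index: rows).
  The space \<open>K\<^sup>n\<^sup>\<times>\<^sup>m \<otimes> K\<^sup>m\<^sup>\<times>\<^sup>p \<otimes> K\<^sup>p\<^sup>\<times>\<^sup>n\<close> is modelled by coordinates with respect to the
  products \<open>a\<^sub>i\<^sub>j \<otimes> b\<^sub>k\<^sub>l \<otimes> c\<^sub>r\<^sub>s\<close> of matrix units; the coordinate of \<open>T\<close> there is
  \<open>T $ i $ j $ k $ l $ r $ s\<close>.  Dimensions are finite index types, so that the
  numeral type \<open>5\<close> stands for an index set with five elements.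
\<close>

type_synonym ('a, 'n, 'm, 'p) mm_tensor = "'a^'n^'p^'p^'m^'m^'n"

definition tensor3 ::
  "'a::field^'m^'n \<Rightarrow> 'a^'p^'m \<Rightarrow> 'a^'n^'p \<Rightarrow> ('a, 'n::finite, 'm::finite, 'p::finite) mm_tensor"
  where "tensor3 \<alpha> \<beta> \<gamma> = (\<chi> i j k l r s. \<alpha> $ i $ j * \<beta> $ k $ l * \<gamma> $ r $ s)"

definition mat_unit :: "'r::finite \<Rightarrow> 'c::finite \<Rightarrow> 'a::field^'c^'r"
  where "mat_unit u v = (\<chi> i j. if i = u \<and> j = v then 1 else 0)"

definition matmul_tensor :: "('a::field, 'n::finite, 'm::finite, 'p::finite) mm_tensor"
  where "matmul_tensor =
    (\<Sum>i\<in>UNIV. \<Sum>j\<in>UNIV. \<Sum>k\<in>UNIV. tensor3 (mat_unit i j) (mat_unit j k) (mat_unit k i))"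

definition rank_one :: "('a::field, 'n::finite, 'm::finite, 'p::finite) mm_tensor \<Rightarrow> bool"
  where "rank_one T \<longleftrightarrow> (\<exists>\<alpha> \<beta> \<gamma>. \<alpha> \<noteq> 0 \<and> \<beta> \<noteq> 0 \<and> \<gamma> \<noteq> 0 \<and> T = tensor3 \<alpha> \<beta> \<gamma>)"

definition mm_scheme :: "('a::field, 'n::finite, 'm::finite, 'p::finite) mm_tensor multiset \<Rightarrow> bool"
  where "mm_scheme S \<longleftrightarrow> (\<forall>T\<in>#S. rank_one T) \<and> \<Sum>\<^sub># S = matmul_tensor"

text \<open>
  \<open>tensor3\<close> is trilinear, and every array of coordinates is a sum of elementary tensors.
\<close>

lemma tensor3_add:
  "tensor3 (\<alpha> + \<alpha>') \<beta> \<gamma> = tensor3 \<alpha> \<beta> \<gamma> + tensor3 \<alpha>' \<beta> \<gamma>"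
  "tensor3 \<alpha> (\<beta> + \<beta>') \<gamma> = tensor3 \<alpha> \<beta> \<gamma> + tensor3 \<alpha> \<beta>' \<gamma>"
  "tensor3 \<alpha> \<beta> (\<gamma> + \<gamma>') = tensor3 \<alpha> \<beta> \<gamma> + tensor3 \<alpha> \<beta> \<gamma>'"
  by (simp_all add: tensor3_def vec_eq_iff algebra_simps)

lemma tensor3_scale:
  "tensor3 (\<chi> i j. c * \<alpha> $ i $ j) \<beta> \<gamma> = (\<chi> i j k l r s. c * tensor3 \<alpha> \<beta> \<gamma> $ i $ j $ k $ l $ r $ s)"
  "tensor3 \<alpha> (\<chi> i j. c * \<beta> $ i $ j) \<gamma> = (\<chi> i j k l r s. c * tensor3 \<alpha> \<beta> \<gamma> $ i $ j $ k $ l $ r $ s)"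
  "tensor3 \<alpha> \<beta> (\<chi> i j. c * \<gamma> $ i $ j) = (\<chi> i j k l r s. c * tensor3 \<alpha> \<beta> \<gamma> $ i $ j $ k $ l $ r $ s)"
  by (simp_all add: tensor3_def vec_eq_iff algebra_simps)

lemma tensor3_expansion:
  fixes T :: "('a::field, 'n::finite, 'm::finite, 'p::finite) mm_tensor"
  shows "T = (\<Sum>i\<in>UNIV. \<Sum>j\<in>UNIV. \<Sum>k\<in>UNIV. \<Sum>l\<in>UNIV. \<Sum>r\<in>UNIV. \<Sum>s\<in>UNIV.
    tensor3 (\<chi> i' j'. T $ i $ j $ k $ l $ r $ s * mat_unit i j $ i' $ j') (mat_unit k l) (mat_unit r s))"
proof -
  have *: "x * (if a \<and> b then 1 else 0) * (if c \<and> d then 1 else 0) * (if e \<and> f then 1 else 0)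
    = (if f then if e then if d then if c then if b then if a then x else 0 else 0 else 0 else 0 else 0 else 0)"
    for x :: 'a and a b c d e f by simp
  have **: "(\<Sum>x\<in>A. if b then f x else 0) = (if b then \<Sum>x\<in>A. f x else 0)"
    for A :: "'i set" and b and f :: "'i \<Rightarrow> 'a" by simp
  show ?thesis
    by (simp only: vec_eq_iff sum_component tensor3_def mat_unit_def vec_lambda_beta * **
        sum.delta' sum.delta finite UNIV_I if_True) (simp add: eq_commute)
qed

end

(*
  The witnesses are explicit and were found by random walks in flip graphs: a flip replaces
  a*b*c + a*b'*c' by a*(b+b')*c + a*b'*(c+c') and is occasionally followed by a merge of two terms.
  A matrix over Z_2 is encoded by the natural number whose binary digits are its entries in row-major
  order, lowest digit first.  Fixing a position u in the first and v in the second factor, the sum of the scheme becomes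
  the exclusive or of the third masks of those terms whose first two masks have the digits u and v set,
  so the claim reduces to 20 * 25 and 25 * 25 equations between natural numbers.

  For n = m = p = 5 the walk was confined to schemes invariant under the cyclic shift of the three
  factors; it ended in a scheme of rank 93 with 30 orbits of length three and three cubes, one of
  which is split into two terms to obtain rank exactly 94.
*)

theory Submission
  imports Defs
begin

section \<open>Matrices over \<open>bit\<close> as binary masks\<close>

definition mask_matrix ::
  "('r \<Rightarrow> nat) \<Rightarrow> ('c \<Rightarrow> nat) \<Rightarrow> nat \<Rightarrow> nat \<Rightarrow> bit^'c::finite^'r::finite"
  where "mask_matrix f g w x = (\<chi> i j. of_bool (bit x (f i * w + g j)))"

text \<open>A nonzero mask has a set digit, and the bound \<open>x < 2 ^ (h * w)\<close> forces it
  below \<open>h * w\<close>. Its quotient and remainder by \<open>w\<close> are then the numbers of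
  an actual row and column.\<close>

lemma mask_matrix_nonzero:
  fixes f :: "'r::finite \<Rightarrow> nat" and g :: "'c::finite \<Rightarrow> nat"
  assumes f: "bij_betw f UNIV {..<h}" and g: "bij_betw g UNIV {..<w}"
    and x: "x \<noteq> 0" "x < 2 ^ (h * w)"
  shows "mask_matrix f g w x \<noteq> 0"
proof -
  from x(1) obtain q where q: "bit x q"
    by (metis bit_eq_iff bit_0_eq bot_apply bot_bool_def)
  have "q < h * w"
  proof (rule ccontr)
    assume "\<not> q < h * w"
    then have "x < 2 ^ q"
      using x(2) by (meson less_le_trans one_le_numeral not_less power_increasing)
    with q show False
      by (simp add: bit_nat_def)
  qed
  then have "w > 0" "q div w < h"
    by (auto simp: less_mult_imp_div_less intro: gr0I)
  then obtain i j where "f i = q div w" "g j = q mod w"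
    using f g by (metis bij_betw_iff_bijections lessThan_iff mod_less_divisor)
  with q have "mask_matrix f g w x $ i $ j = 1"
    by (simp add: mask_matrix_def)
  then show ?thesis
    by auto
qed

section \<open>Schemes as exclusive-or conditions on masks\<close>

fun select :: "nat \<Rightarrow> (nat \<times> 'a) list \<Rightarrow> 'a list"
  where
    "select q [] = []"
  | "select q ((x, y) # xs) = (if bit x q then y # select q xs else select q xs)"

fun xor_list :: "nat list \<Rightarrow> nat"
  where
    "xor_list [] = 0"
  | "xor_list (x # xs) = xor x (xor_list xs)"

text \<open>
  With \<open>u\<close> the position \<open>(i, j)\<close> and \<open>v\<close> the position \<open>(k, l)\<close>, this is the mask of \<open>c\<^sub>l\<^sub>i\<close> if
  \<open>j = k\<close>, and of the zero matrix otherwise.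
\<close>

definition matmul_mask :: "nat \<Rightarrow> nat \<Rightarrow> nat \<Rightarrow> nat \<Rightarrow> nat \<Rightarrow> nat"
  where "matmul_mask n m p u v = (if u mod m = v div p then 2 ^ (v mod p * n + u div m) else 0)"

definition mask_scheme :: "nat \<Rightarrow> nat \<Rightarrow> nat \<Rightarrow> (nat \<times> nat \<times> nat) list \<Rightarrow> bool"
  where "mask_scheme n m p ts \<longleftrightarrow>
    (\<forall>(a, b, c)\<in>set ts. a \<in> {0<..<2 ^ (n * m)} \<and> b \<in> {0<..<2 ^ (m * p)} \<and> c \<in> {0<..<2 ^ (p * n)}) \<and>
    (\<forall>u<n * m. \<forall>v<m * p. xor_list (select v (select u ts)) = matmul_mask n m p u v)"

text \<open>
  Since \<open>bit x u\<close> says that \<open>x div 2 ^ u\<close> is odd, halving all masks at each step visits the positions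
  in increasing order, and every step costs one rewrite at the lowest binary digit of each numeral.
\<close>

fun odds :: "(nat \<times> 'a) list \<Rightarrow> 'a list"
  where
    "odds [] = []"
  | "odds ((x, y) # xs) = (if odd x then y # odds xs else odds xs)"

fun halves :: "(nat \<times> 'a) list \<Rightarrow> (nat \<times> 'a) list"
  where
    "halves [] = []"
  | "halves ((x, y) # xs) = (x div 2, y) # halves xs"

fun check_columns :: "nat list \<Rightarrow> (nat \<times> nat) list \<Rightarrow> bool"
  where
    "check_columns [] ts \<longleftrightarrow> True"
  | "check_columns (e # es) ts \<longleftrightarrow> xor_list (odds ts) = e \<and> check_columns es (halves ts)"

fun check_rows :: "nat list list \<Rightarrow> (nat \<times> nat \<times> nat) list \<Rightarrow> bool"
  where
    "check_rows [] ts \<longleftrightarrow> True"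
  | "check_rows (es # ess) ts \<longleftrightarrow> check_columns es (odds ts) \<and> check_rows ess (halves ts)"

lemma select_0: "select 0 ts = odds ts"
  by (induction ts rule: odds.induct) (auto simp: bit_0)

lemma select_Suc: "select (Suc u) ts = select u (halves ts)"
  by (induction ts rule: halves.induct) (auto simp: bit_Suc)

lemma check_columns_iff:
  "check_columns es ts \<longleftrightarrow> (\<forall>v<length es. xor_list (select v ts) = es ! v)"
  by (induction es ts rule: check_columns.induct) (auto simp: select_0 select_Suc less_Suc_eq_0_disj)

lemma check_rows_iff:
  "check_rows ess ts \<longleftrightarrow> (\<forall>u<length ess. check_columns (ess ! u) (select u ts))"
  by (induction ess ts rule: check_rows.induct) (auto simp: select_0 select_Suc less_Suc_eq_0_disj)

fun check_masks :: "nat \<Rightarrow> nat \<Rightarrow> nat \<Rightarrow> (nat \<times> nat \<times> nat) list \<Rightarrow> bool" where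
  "check_masks A B C [] \<longleftrightarrow> True"
| "check_masks A B C ((a, b, c) # ts) \<longleftrightarrow>
    0 < a \<and> a < A \<and> 0 < b \<and> b < B \<and> 0 < c \<and> c < C \<and> check_masks A B C ts"

lemma check_masks_iff:
  "check_masks A B C ts \<longleftrightarrow> (\<forall>(a, b, c)\<in>set ts. a \<in> {0<..<A} \<and> b \<in> {0<..<B} \<and> c \<in> {0<..<C})"
  by (induction ts) auto

lemma mask_scheme_code:
  "mask_scheme n m p ts \<longleftrightarrow>
    check_masks (2 ^ (n * m)) (2 ^ (m * p)) (2 ^ (p * n)) ts \<and>
    check_rows (map (\<lambda>u. map (matmul_mask n m p u) [0..<m * p]) [0..<n * m]) ts"
  by (simp add: mask_scheme_def check_masks_iff check_rows_iff check_columns_iff)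

section \<open>Evaluation on binary numerals\<close>

lemma odds_numeral:
  "odds ((0, y) # xs) = odds xs"
  "odds ((1, y) # xs) = y # odds xs"
  "odds ((numeral (Num.Bit0 k), y) # xs) = odds xs"
  "odds ((numeral (Num.Bit1 k), y) # xs) = y # odds xs"
  by simp_all

lemma halves_numeral:
  "halves ((0, y) # xs) = (0, y) # halves xs"
  "halves ((1, y) # xs) = (0, y) # halves xs"
  "halves ((numeral (Num.Bit0 k), y) # xs) = (numeral k, y) # halves xs"
  "halves ((numeral (Num.Bit1 k), y) # xs) = (numeral k, y) # halves xs"
  by simp_all

lemma double_numeral:
  "2 * 0 = (0::nat)" "2 * 1 = (2::nat)" "2 * numeral k = (numeral (Num.Bit0 k) :: nat)"
  "1 + 0 = (1::nat)" "1 + numeral (Num.Bit0 k) = (numeral (Num.Bit1 k) :: nat)"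
  by simp_all

text \<open>A rewrite set for \<open>simp only\<close>: parity and halving inspect only the last
  constructor of a numeral. The rules \<open>double_numeral\<close> fold the doublings and
  increments left by \<open>xor_numerals\<close> back into numerals.\<close>

lemmas check_rows_numeral =
  check_rows.simps check_columns.simps odds.simps(1) odds_numeral halves.simps(1) halves_numeral
  xor_list.simps xor_numerals xor_self_eq xor.left_neutral xor.right_neutral double_numeral
  numeral_One One_nat_def[symmetric] simp_thms

section \<open>From masks to tensors\<close>

text \<open>Addition in \<open>bit\<close> is exclusive or of digits, and the first two factors of a
  summand are both 1 exactly for the triples that survive the two selections.\<close>

lemma sum_list_bits_select:
  "(\<Sum>(a, b, c)\<leftarrow>ts. of_bool (bit a u) * of_bool (bit b v) * of_bool (bit c w)) =
    (of_bool (bit (xor_list (select v (select u ts))) w) :: bit)"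
  by (induction ts) (auto simp: bit_xor_iff split: if_splits)

lemma mat_unit_nth: "mat_unit u v $ i $ j = of_bool (i = u \<and> j = v)"
  by (simp add: mat_unit_def)

lemma matmul_tensor_nth:
  "(matmul_tensor :: ('a::field, 'n::finite, 'm::finite, 'p::finite) mm_tensor) $ i $ j $ k $ l $ r $ s =
    of_bool (j = k \<and> l = r \<and> s = i)"
proof -
  \<comment> \<open>Moving conditions out of inner sums lets \<open>sum.delta\<close> collapse the
    three sums to the one term \<open>x = i\<close>, \<open>y = j\<close>,
    \<open>z = l\<close>.\<close>
  have if_out: "(\<Sum>x\<in>X. if b then e x else 0) = (if b then \<Sum>x\<in>X. e x else 0)"
    for X :: "'i set" and b and e :: "'i \<Rightarrow> 'a"
    by simp
  have "(matmul_tensor :: ('a, 'n, 'm, 'p) mm_tensor) $ i $ j $ k $ l $ r $ s =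
      (\<Sum>x\<in>UNIV. \<Sum>y\<in>UNIV. \<Sum>z\<in>UNIV.
        if x = i then if y = j then if z = l then of_bool (j = k \<and> l = r \<and> s = i) else 0 else 0 else 0)"
    unfolding matmul_tensor_def tensor3_def
    by (simp only: sum_component vec_lambda_beta mat_unit_nth, intro sum.cong refl) auto
  also have "\<dots> = of_bool (j = k \<and> l = r \<and> s = i)"
    by (simp only: if_out sum.delta finite UNIV_I if_True)
  finally show ?thesis .
qed

lemma sum_list_vec_nth: "sum_list xs $ i = (\<Sum>x\<leftarrow>xs. x $ i)"
  by (induction xs) auto

lemma mm_scheme_of_mask_scheme:
  assumes ts: "mask_scheme CARD('n) CARD('m) CARD('p) ts"
  shows "\<exists>S :: (bit, 'n::finite, 'm::finite, 'p::finite) mm_tensor multiset.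
    mm_scheme S \<and> size S = length ts"
proof -
  \<comment> \<open>Any numbering of the index types will do, provided each type uses the same one
    in both matrices where it occurs.\<close>
  obtain f :: "'n \<Rightarrow> nat" where f: "bij_betw f UNIV {..<CARD('n)}"
    using ex_bij_betw_finite_nat[of "UNIV :: 'n set"] by (auto simp: atLeast0LessThan)
  obtain g :: "'m \<Rightarrow> nat" where g: "bij_betw g UNIV {..<CARD('m)}"
    using ex_bij_betw_finite_nat[of "UNIV :: 'm set"] by (auto simp: atLeast0LessThan)
  obtain h :: "'p \<Rightarrow> nat" where h: "bij_betw h UNIV {..<CARD('p)}"
    using ex_bij_betw_finite_nat[of "UNIV :: 'p set"] by (auto simp: atLeast0LessThan)
  have lt: "f i < CARD('n)" "g j < CARD('m)" "h k < CARD('p)" for i j k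
    using f g h by (auto dest: bij_betw_apply)
  have inj: "f i = f i' \<longleftrightarrow> i = i'" "g j = g j' \<longleftrightarrow> j = j'" "h k = h k' \<longleftrightarrow> k = k'" for i i' j j' k k'
    using f g h by (auto simp: bij_betw_def inj_eq)
  have pair_lt: "x * w + y < v * w" if "x < v" "y < w" for x y v w :: nat
  proof -
    have "x * w + y < Suc x * w"
      using that by simp
    also have "\<dots> \<le> v * w"
      using that by (intro mult_right_mono) auto
    finally show ?thesis .
  qed
  define A where "A = mask_matrix f g CARD('m)"
  define B where "B = mask_matrix g h CARD('p)"
  define C where "C = mask_matrix h f CARD('n)"
  define T where "T = (\<lambda>(a, b, c). tensor3 (A a) (B b) (C c))"
  have "rank_one (T t)" if "t \<in> set ts" for t
  proof -
    obtain a b c where t: "t = (a, b, c)"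
      by (cases t)
    with that ts have "a \<in> {0<..<2 ^ (CARD('n) * CARD('m))}" "b \<in> {0<..<2 ^ (CARD('m) * CARD('p))}"
      "c \<in> {0<..<2 ^ (CARD('p) * CARD('n))}"
      by (auto simp: mask_scheme_def)
    then have "A a \<noteq> 0" "B b \<noteq> 0" "C c \<noteq> 0"
      by (simp_all add: A_def B_def C_def mask_matrix_nonzero[OF f g] mask_matrix_nonzero[OF g h]
          mask_matrix_nonzero[OF h f])
    then show ?thesis
      by (auto simp: rank_one_def T_def t)
  qed
  moreover have "(\<Sum>t\<leftarrow>ts. T t) = matmul_tensor"
  proof -
    have "(\<Sum>t\<leftarrow>ts. T t) $ i $ j $ k $ l $ r $ s = matmul_tensor $ i $ j $ k $ l $ r $ s" for i j k l r s
    proof -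
      let ?u = "f i * CARD('m) + g j" and ?v = "g k * CARD('p) + h l" and ?w = "h r * CARD('n) + f s"
      have T_nth: "T t $ i $ j $ k $ l $ r $ s =
          (case t of (a, b, c) \<Rightarrow> of_bool (bit a ?u) * of_bool (bit b ?v) * of_bool (bit c ?w))" for t
        by (cases t) (simp add: T_def tensor3_def A_def B_def C_def mask_matrix_def)
      have "xor_list (select ?v (select ?u ts)) =
          (if ?u mod CARD('m) = ?v div CARD('p) then 2 ^ (?v mod CARD('p) * CARD('n) + ?u div CARD('m)) else 0)"
        using ts pair_lt[OF lt(1,2)] pair_lt[OF lt(2,3)] by (simp add: mask_scheme_def matmul_mask_def)
      also have "\<dots> = (if j = k then 2 ^ (h l * CARD('n) + f i) else 0)"
        using lt by (simp add: inj)
      finally have "bit (xor_list (select ?v (select ?u ts))) ?w \<longleftrightarrow>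
          j = k \<and> h r * CARD('n) + f s = h l * CARD('n) + f i"
        by (auto simp: bit_exp_iff)
      \<comment> \<open>Uniqueness of quotient and remainder, as \<open>f s\<close> and
        \<open>f i\<close> are below \<open>CARD('n)\<close>.\<close>
      also have "h r * CARD('n) + f s = h l * CARD('n) + f i \<longleftrightarrow> r = l \<and> s = i"
      proof
        assume eq: "h r * CARD('n) + f s = h l * CARD('n) + f i"
        from arg_cong[OF eq, of "\<lambda>x. x div CARD('n)"] arg_cong[OF eq, of "\<lambda>x. x mod CARD('n)"]
        show "r = l \<and> s = i"
          using lt by (simp add: inj)
      qed simp
      finally have "of_bool (bit (xor_list (select ?v (select ?u ts))) ?w) =
          (matmul_tensor $ i $ j $ k $ l $ r $ s :: bit)"
        by (auto simp: matmul_tensor_nth)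
      then show ?thesis
        using sum_list_bits_select[of ?u ?v ?w ts] by (simp add: sum_list_vec_nth o_def T_nth)
    qed
    then show ?thesis
      by (simp add: vec_eq_iff)
  qed
  ultimately have "mm_scheme (mset (map T ts))"
    by (auto simp: mm_scheme_def sum_mset_sum_list simp del: mset_map)
  then show ?thesis
    by (intro exI[of _ "mset (map T ts)"]) simp
qed

section \<open>The explicit schemes and their verification\<close>

definition scheme_455 :: "(nat \<times> nat \<times> nat) list"
  where "scheme_455 = [
    (96, 1081376, 410722), (832, 4325504, 419424), (960, 11895136, 689249),
    (2050, 5423776, 410705), (7175, 21119104, 417792), (7975, 21119104, 1045840),
    (7983, 4325504, 629136), (8192, 5947568, 410781), (10338, 22200496, 410688),
    (30720, 29770640, 361617), (30750, 4849792, 623697), (61507, 29754256, 349249),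
    (65536, 28689264, 689297), (67584, 6291654, 9265), (67616, 6298662, 9316),
    (67648, 12976512, 357473), (67650, 16777744, 480321), (68480, 12983648, 9313),
    (72704, 4596879, 36411), (72736, 3553423, 1638), (73504, 7347200, 2730),
    (73728, 5617838, 9371), (73760, 2504878, 9286), (74432, 7569408, 9291),
    (96256, 29777815, 33937), (97312, 7347207, 1092), (98304, 4866192, 607389),
    (98307, 29754240, 345169), (100353, 6322950, 17489), (101376, 6297606, 17412),
    (101475, 16793616, 279616), (105472, 2505871, 56589), (105473, 27679887, 21840),
    (105476, 27675787, 4353), (105487, 2501771, 39312), (106496, 7108638, 17565),
    (107521, 31488030, 17472), (124707, 16793600, 905216), (129024, 6298631, 54420),
    (129025, 2514839, 21569), (129046, 14691339, 627776), (129046, 27929739, 589824),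
    (129053, 6302731, 5201), (236544, 6297600, 43530), (236672, 7743499, 8706),
    (237344, 1454091, 11979), (262152, 29213024, 689233), (264202, 5421408, 9297),
    (264554, 14858251, 9280), (265098, 11534699, 9281), (269327, 29774987, 36593),
    (269679, 3422219, 1632), (270127, 32664704, 2720), (270336, 6488064, 9467),
    (270600, 17301504, 131072), (270688, 6728715, 9314), (271040, 371723, 9323),
    (284029, 11545611, 1088), (292886, 4861067, 33873), (328648, 11911520, 689217),
    (433167, 31488000, 43680), (433615, 7747595, 8736), (433967, 26624011, 12001),
    (686102, 31457280, 33857), (697024, 7744523, 1097), (851994, 16793600, 558416),
    (859936, 6695947, 2457), (859951, 2501643, 3536), (859960, 31874059, 273),
    (859965, 10886155, 1360), (1013760, 6291456, 33985), (1014750, 16384, 558145),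
    (1018781, 7740427, 1089)]"

definition orbits_555 :: "(nat \<times> nat \<times> nat) list"
  where "orbits_555 = [
    (5, 4096, 1025), (11, 8576, 32768), (14, 8192, 26594098), (25, 29377024, 1048608),
    (32, 168965, 29838208), (32, 168972, 15139264), (64, 262400, 473102),
    (128, 41984, 18893394), (320, 262144, 19464768), (512, 17302016, 14694862),
    (5120, 8388609, 473102), (5152, 8193, 29838226), (5294, 8192, 608274),
    (5632, 8388608, 473102), (8200, 30278528, 11296), (8256, 262432, 168974),
    (8264, 262528, 44032), (8488, 168960, 10240), (8584, 37888, 10241),
    (8704, 26739200, 5248174), (8712, 29884928, 1059872), (16896, 9437184, 5248188),
    (16912, 12582912, 1074208), (24576, 26231312, 5248160), (24577, 29377040, 1053728),
    (58368, 18891280, 8388736), (168988, 18891264, 8388640), (262656, 19399168, 8388928),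
    (524800, 2097152, 8389376), (946204, 18874368, 8388608)]"

text \<open>Thirty orbits give 90 triples. The first two triples appended are cubes; the last two
  add up to the cube of \<open>4097\<close>, whose first factor is split as 1 + 4096.\<close>

definition scheme_555 :: "(nat \<times> nat \<times> nat) list"
  where "scheme_555 = concat (map (\<lambda>(a, b, c). [(a, b, c), (b, c, a), (c, a, b)]) orbits_555) @ [
    (16777216, 16777216, 16777216), (262208, 262208, 262208), (1, 4097, 4097),
    (4096, 4097, 4097)]"

lemma mask_scheme_455: "mask_scheme 4 5 5 scheme_455"
proof -
  have "check_masks (2 ^ 20) (2 ^ 25) (2 ^ 20) scheme_455"
    by (simp add: scheme_455_def)
  moreover have "check_rows (map (\<lambda>u. map (matmul_mask 4 5 5 u) [0..<25]) [0..<20]) scheme_455"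
    \<comment> \<open>The first call only computes the table of expected masks, keeping
      \<open>check_rows\<close> folded; the second runs the check by digit rewriting.\<close>
    by (simp add: matmul_mask_def upt_rec del: check_rows.simps)
      (simp only: scheme_455_def check_rows_numeral)
  ultimately show ?thesis
    by (simp add: mask_scheme_code)
qed

lemma mask_scheme_555: "mask_scheme 5 5 5 scheme_555"
proof -
  have "check_masks (2 ^ 25) (2 ^ 25) (2 ^ 25) scheme_555"
    by (simp add: scheme_555_def orbits_555_def)
  moreover have "check_rows (map (\<lambda>u. map (matmul_mask 5 5 5 u) [0..<25]) [0..<25]) scheme_555"
    by (simp add: matmul_mask_def upt_rec del: check_rows.simps)
      (simp only: scheme_555_def orbits_555_def concat.simps list.map prod.case append.simps check_rows_numeral)
  ultimately show ?thesis
    by (simp add: mask_scheme_code)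
qed

theorem mainTheorem2:
  shows "(\<exists>S :: (bit, 4, 5, 5) mm_tensor multiset. mm_scheme S \<and> size S = 73) \<and>
         (\<exists>S :: (bit, 5, 5, 5) mm_tensor multiset. mm_scheme S \<and> size S = 94)"
proof
  have "length scheme_455 = 73"
    by (simp add: scheme_455_def)
  then show "\<exists>S :: (bit, 4, 5, 5) mm_tensor multiset. mm_scheme S \<and> size S = 73"
    using mm_scheme_of_mask_scheme[where 'n = 4 and 'm = 5 and 'p = 5, of scheme_455] mask_scheme_455
    by simp
  have "length scheme_555 = 94"
    by (simp add: scheme_555_def orbits_555_def)
  then show "\<exists>S :: (bit, 5, 5, 5) mm_tensor multiset. mm_scheme S \<and> size S = 94"
    using mm_scheme_of_mask_scheme[where 'n = 5 and 'm = 5 and 'p = 5, of scheme_555] mask_scheme_555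
    by simp
qed

end
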